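(* Let $p\ge1$ and $\phi\in GL(n)$, and let $\gamma_\phi(x)=e^{-\|\phi x\|^2/2}$. Then $E_p(\gamma_\phi)=\gamma_\phi$.
   Context: For a convex $u$, $u^*(y)=\sup_x\{\langle x,y\rangle-u(x)\}$. For $f=e^{-u}$ with $u$ convex, $u\ge0$, $u^{**}=u$, $u(0)=0$, $u(x)\to\infty$ as $|x|\to\infty$: $h_f=u^*$; $J(f)=\int f\,dx$; $J(f^\diamond)=\int(nf+f\log f)\,dx$; $\mu_p(f,\cdot)$ defined by $\int g\,d\mu_p(f,\cdot)=\int_{\mathrm{dom}(u)}g(\nabla u(x))h_f(\nabla u(x))^{1-p}f(x)\,dx$; $\delta J_p(f,g)=\frac1p\int h_g^p\,d\mu_p(f,\cdot)$; $\overline\delta J_p(f,g)=(p\,\delta J_p(f,g)/J(f^\diamond))^{1/p}$. The $L_p$ John ellipsoid $E_pf$ of $f$ is the unique Gaussian function $\gamma_\psi$ ($\psi\in GL(n)$) that maximizes $J(\gamma_\psi)$ subject to $\overline\delta J_p(f,\gamma_\psi)\le1$. *)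

theory Defs
  imports "HOL-Analysis.Analysis"
begin

text \<open>Functions f = e^{-u} on R^n, R^n rendered as real^'n. The potential is
  u = - ln f on the support {x. f x > 0} = dom(u) (u = +infinity off the support).\<close>

definition gauss :: "real^'n^'n \<Rightarrow> real^'n \<Rightarrow> real" where
  "gauss \<phi> x = exp (- (norm (\<phi> *v x))\<^sup>2 / 2)"

definition pot :: "(real^'n \<Rightarrow> real) \<Rightarrow> real^'n \<Rightarrow> real" where
  "pot f x = - ln (f x)"

definition domf :: "(real^'n \<Rightarrow> real) \<Rightarrow> (real^'n) set" where
  "domf f = {x. 0 < f x}"

text \<open>support function h_f = u^*, the Legendre transform of u\<close>
definition supp_fun :: "(real^'n \<Rightarrow> real) \<Rightarrow> real^'n \<Rightarrow> real" where
  "supp_fun f y = (SUP x\<in>domf f. inner x y - pot f x)"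

text \<open>gradient of u at x\<close>
definition grad_pot :: "(real^'n \<Rightarrow> real) \<Rightarrow> real^'n \<Rightarrow> real^'n" where
  "grad_pot f x = (THE D. GDERIV (pot f) x :> D)"

text \<open>J(f) = integral of f\<close>
definition Jf :: "(real^'n \<Rightarrow> real) \<Rightarrow> real" where
  "Jf f = (LINT x|lborel. f x)"

text \<open>J(f^diamond) = integral of (n f + f log f)\<close>
definition Jdiamond :: "(real^'n \<Rightarrow> real) \<Rightarrow> real" where
  "Jdiamond f = (LINT x|lborel. real CARD('n) * f x + f x * ln (f x))"

text \<open>integral of g against the L_p surface area measure mu_p(f,.)\<close>
definition mu_int :: "real \<Rightarrow> (real^'n \<Rightarrow> real) \<Rightarrow> (real^'n \<Rightarrow> real) \<Rightarrow> real" where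
  "mu_int p f g = (LINT x:domf f|lborel.
      g (grad_pot f x) * (supp_fun f (grad_pot f x)) powr (1 - p) * f x)"

definition deltaJ :: "real \<Rightarrow> (real^'n \<Rightarrow> real) \<Rightarrow> (real^'n \<Rightarrow> real) \<Rightarrow> real" where
  "deltaJ p f g = (1 / p) * mu_int p f (\<lambda>y. (supp_fun g y) powr p)"

definition deltaJ_bar :: "real \<Rightarrow> (real^'n \<Rightarrow> real) \<Rightarrow> (real^'n \<Rightarrow> real) \<Rightarrow> real" where
  "deltaJ_bar p f g = (p * deltaJ p f g / Jdiamond f) powr (1 / p)"

text \<open>L_p John ellipsoid: the unique Gaussian gamma_psi (psi in GL(n)) maximizing
  J(gamma_psi) subject to deltaJ_bar p f gamma_psi \<le> 1.\<close>
definition john_Lp :: "real \<Rightarrow> (real^'n \<Rightarrow> real) \<Rightarrow> (real^'n \<Rightarrow> real)" where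
  "john_Lp p f = (THE g. (\<exists>\<psi>. invertible \<psi> \<and> g = gauss \<psi>)
      \<and> deltaJ_bar p f g \<le> 1
      \<and> (\<forall>\<psi>. invertible \<psi> \<and> deltaJ_bar p f (gauss \<psi>) \<le> 1 \<longrightarrow> Jf (gauss \<psi>) \<le> Jf g))"

end

theory Submission
  imports Defs "HOL-Probability.Distributions"
begin

text \<open>Write \<open>\<gamma>\<^sub>\<psi> x = g (\<psi> x)\<close> with \<open>g\<close> the standard Gaussian and put
  \<open>B = (\<phi> \<psi>\<^sup>-\<^sup>1)\<^sup>T\<close>. The substitution \<open>y = \<phi> x\<close> turns every quantity into a Gaussian
  integral: \<open>J(\<gamma>\<^sub>\<psi>) = (2\<pi>)\<^sup>n\<^sup>/\<^sup>2 / |det \<psi>|\<close>, \<open>J(\<gamma>\<^sub>\<phi>\<^sup>\<diamond>) = M / |det \<phi>|\<close> with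
  \<open>M = \<integral> |y|\<^sup>2/2 g = n/2 (2\<pi>)\<^sup>n\<^sup>/\<^sup>2\<close>, and \<open>p |det \<phi>| \<delta>J\<^sub>p(\<gamma>\<^sub>\<phi>, \<gamma>\<^sub>\<psi>)\<close> is the
  integral of \<open>(|B y|\<^sup>2/2)\<^sup>p (|y|\<^sup>2/2)\<^sup>1\<^sup>-\<^sup>p g\<close>; in particular \<open>\<gamma>\<^sub>\<phi>\<close> itself is feasible.

  If \<open>\<gamma>\<^sub>\<psi>\<close> is feasible, Bernoulli's inequality bounds \<open>\<integral> |B y|\<^sup>2/2 g\<close> by \<open>M\<close>.
  The tangent inequality \<open>g (B y) \<ge> g y (1 + |y|\<^sup>2/2 - |B y|\<^sup>2/2)\<close>, integrated, then
  gives \<open>|det B| \<le> 1\<close>, i.e. \<open>J(\<gamma>\<^sub>\<psi>) \<le> J(\<gamma>\<^sub>\<phi>)\<close>. In the case of equality the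
  continuous nonnegative defect of the tangent inequality integrates to zero, so it vanishes,
  \<open>B\<close> is orthogonal and \<open>\<gamma>\<^sub>\<psi> = \<gamma>\<^sub>\<phi>\<close>. The value of \<open>M\<close> comes from the same
  tangent inequality for \<open>B = \<surd>s I\<close>.\<close>

section \<open>Linear changes of variables\<close>

text \<open>The change of variables theorems of HOL-Analysis require a well-ordered index type. A copy
  of the finite index type, ordered by \<open>to_nat\<close>, supplies one, and everything is transported
  back along the resulting permutation of coordinates.\<close>

typedef 'a wellorder_copy = "UNIV :: 'a set" by simp

instance wellorder_copy :: (finite) finite
proof
  have "UNIV = Abs_wellorder_copy ` UNIV"
    by (metis Rep_wellorder_copy_inverse surj_def)
  then show "finite (UNIV :: 'a wellorder_copy set)"
    by (metis finite_imageI finite)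
qed

instantiation wellorder_copy :: (finite) wellorder
begin

definition "x \<le> y \<longleftrightarrow> to_nat (Rep_wellorder_copy x) \<le> to_nat (Rep_wellorder_copy y)"
definition "x < y \<longleftrightarrow> to_nat (Rep_wellorder_copy x) < to_nat (Rep_wellorder_copy y)"

instance
proof
  fix x y z :: "'a wellorder_copy"
  show "x < y \<longleftrightarrow> x \<le> y \<and> \<not> y \<le> x" "x \<le> x" "x \<le> y \<or> y \<le> x"
    by (auto simp: less_eq_wellorder_copy_def less_wellorder_copy_def)
  show "x \<le> y \<Longrightarrow> y \<le> z \<Longrightarrow> x \<le> z"
    by (simp add: less_eq_wellorder_copy_def)
  show "x \<le> y \<Longrightarrow> y \<le> x \<Longrightarrow> x = y"
    by (simp add: less_eq_wellorder_copy_def Rep_wellorder_copy_inject)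
next
  fix P :: "'a wellorder_copy \<Rightarrow> bool" and a
  assume step: "\<And>x. (\<And>y. y < x \<Longrightarrow> P y) \<Longrightarrow> P x"
  show "P a"
    by (induct a rule: measure_induct_rule[of "\<lambda>x. to_nat (Rep_wellorder_copy x)"])
      (metis step less_wellorder_copy_def)
qed

end

lemma bij_Rep_wellorder_copy: "bij Rep_wellorder_copy"
  by (metis Rep_wellorder_copy_inverse Abs_wellorder_copy_inverse UNIV_I bij_betw_byWitness subsetI)

definition vec_to_copy :: "'a^'n \<Rightarrow> 'a^'n wellorder_copy" where
  "vec_to_copy x = (\<chi> i. x $ Rep_wellorder_copy i)"

definition vec_from_copy :: "'a^'n wellorder_copy \<Rightarrow> 'a^'n" where
  "vec_from_copy y = (\<chi> j. y $ Abs_wellorder_copy j)"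

definition mat_to_copy :: "'a^'n^'n \<Rightarrow> 'a^'n wellorder_copy^'n wellorder_copy" where
  "mat_to_copy A = (\<chi> i j. A $ Rep_wellorder_copy i $ Rep_wellorder_copy j)"

lemma det_mat_to_copy:
  fixes A :: "'a::comm_ring_1^'n::finite^'n"
  shows "det (mat_to_copy A) = det A"
proof -
  let ?R = Rep_wellorder_copy and ?A = Abs_wellorder_copy
  let ?m = "\<lambda>q x. ?R (q (?A x))"
  have inv_R: "inv_into UNIV ?R = ?A"
    by (rule ext, rule inv_into_f_eq)
      (auto simp: Rep_wellorder_copy_inverse Abs_wellorder_copy_inverse inj_def
        Rep_wellorder_copy_inject)
  have bij_m: "bij_betw ?m {q. q permutes UNIV} {p. p permutes UNIV}"
    using bij_betw_permutations[OF bij_Rep_wellorder_copy] by (simp add: inv_R)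
  have sign_m: "sign (?m q) = sign q" if "q permutes UNIV" for q :: "'n wellorder_copy \<Rightarrow> _"
  proof -
    have "permutes_bij_finite q UNIV UNIV ?R ?A"
      by unfold_locales (auto simp: that bij_Rep_wellorder_copy Rep_wellorder_copy_inverse)
    from permutes_bij_finite.sign_p'[OF this] show ?thesis by simp
  qed
  have prod_m: "(\<Prod>i\<in>UNIV. mat_to_copy A $ i $ q i) = (\<Prod>k\<in>UNIV. A $ k $ ?m q k)" for q
    using prod.reindex_bij_betw[OF bij_Rep_wellorder_copy, of "\<lambda>k. A $ k $ ?m q k"]
    by (simp add: mat_to_copy_def Rep_wellorder_copy_inverse)
  have "det (mat_to_copy A)
      = (\<Sum>q\<in>{q. q permutes UNIV}. of_int (sign (?m q)) * (\<Prod>k\<in>UNIV. A $ k $ ?m q k))"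
    unfolding det_def by (intro sum.cong) (simp_all add: prod_m sign_m)
  also have "\<dots> = det A"
    unfolding det_def by (rule sum.reindex_bij_betw[OF bij_m])
  finally show ?thesis .
qed

lemma vec_from_to_copy [simp]: "vec_from_copy (vec_to_copy x) = x"
  by (simp add: vec_from_copy_def vec_to_copy_def Abs_wellorder_copy_inverse vec_eq_iff)

lemma vec_to_from_copy [simp]: "vec_to_copy (vec_from_copy y) = y"
  by (simp add: vec_from_copy_def vec_to_copy_def Rep_wellorder_copy_inverse vec_eq_iff)

lemma vec_to_copy_matrix_vector_mult:
  fixes A :: "'a::semiring_1^'n^'n"
  shows "vec_to_copy (A *v x) = mat_to_copy A *v vec_to_copy x"
  using sum.reindex_bij_betw[OF bij_Rep_wellorder_copy, of "\<lambda>k. _ $ k * x $ k"]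
  by (simp add: vec_to_copy_def mat_to_copy_def vec_eq_iff matrix_vector_mult_def)

lemma invertible_mat_to_copy:
  fixes A :: "real^'n^'n"
  assumes "invertible A"
  shows "invertible (mat_to_copy A)"
  using assms by (simp add: invertible_det_nz det_mat_to_copy)

lemma linear_vec_to_copy: "linear vec_to_copy"
  by (auto simp: linear_iff vec_to_copy_def vec_eq_iff)

lemma linear_vec_from_copy: "linear vec_from_copy"
  by (auto simp: linear_iff vec_from_copy_def vec_eq_iff)

lemma borel_measurable_linear:
  fixes f :: "'a::euclidean_space \<Rightarrow> 'b::euclidean_space"
  shows "linear f \<Longrightarrow> f \<in> borel_measurable borel"
  by (intro borel_measurable_continuous_onI linear_continuous_on) (simp add: linear_linear)

lemma borel_measurable_matrix_vector_mult [measurable]: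
  "(\<lambda>x. (A :: real^'n^'m) *v x) \<in> borel_measurable borel"
  by (rule borel_measurable_linear) simp

lemma borel_measurable_vec_to_copy [measurable]:
  "(vec_to_copy :: real^'n \<Rightarrow> _) \<in> borel_measurable borel"
  by (rule borel_measurable_linear[OF linear_vec_to_copy])

lemma borel_measurable_vec_from_copy [measurable]:
  "(vec_from_copy :: _ \<Rightarrow> real^'n) \<in> borel_measurable borel"
  by (rule borel_measurable_linear[OF linear_vec_from_copy])

lemma prod_Basis_vec: "(\<Prod>b\<in>(Basis :: (real^'n) set). f b) = (\<Prod>i\<in>UNIV. f (axis i 1))"
proof -
  have "(Basis :: (real^'n) set) = range (\<lambda>i. axis i 1)"
    by (auto simp: Basis_vec_def)
  moreover have "inj (\<lambda>i::'n. axis i (1::real))"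
    by (auto simp: inj_def axis_eq_axis)
  ultimately show ?thesis
    using prod.reindex[of "\<lambda>i. axis i 1" UNIV f] by (simp add: o_def)
qed

lemma distr_lborel_vec_to_copy:
  "distr lborel lborel vec_to_copy = (lborel :: (real^'n::finite wellorder_copy) measure)"
proof (rule lborel_eqI[symmetric])
  fix l u :: "real^'n wellorder_copy"
  assume lu: "\<And>b. b \<in> Basis \<Longrightarrow> l \<bullet> b \<le> u \<bullet> b"
  have le: "l $ i \<le> u $ i" for i
    using lu[of "axis i 1"] by (simp add: inner_axis)
  have pre: "vec_to_copy -` box l u = box (vec_from_copy l) (vec_from_copy u)"
  proof -
    have "x \<in> vec_to_copy -` box l u \<longleftrightarrow> x \<in> box (vec_from_copy l) (vec_from_copy u)" for x
      unfolding mem_box_cart vec_to_copy_def vec_from_copy_def vimage_def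
      by (auto simp: Abs_wellorder_copy_inverse)
        (metis Abs_wellorder_copy_inverse Rep_wellorder_copy_inverse UNIV_I)+
    then show ?thesis by blast
  qed
  have "emeasure (distr lborel lborel vec_to_copy) (box l u)
      = emeasure lborel (box (vec_from_copy l) (vec_from_copy u))"
    by (simp add: emeasure_distr pre)
  also have "\<dots> = (\<Prod>b\<in>Basis. (vec_from_copy u - vec_from_copy l) \<bullet> b)"
    by (rule emeasure_lborel_box) (auto simp: Basis_vec_def inner_axis vec_from_copy_def le)
  also have "\<dots> = (\<Prod>i\<in>UNIV. (u - l) $ Abs_wellorder_copy i)"
    by (simp add: prod_Basis_vec inner_axis vec_from_copy_def)
  also have "\<dots> = (\<Prod>b\<in>Basis. (u - l) \<bullet> b)"
    using prod.reindex_bij_betw[OF bij_Rep_wellorder_copy, of "\<lambda>k. (u - l) $ Abs_wellorder_copy k"]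
    by (simp add: prod_Basis_vec inner_axis Rep_wellorder_copy_inverse)
  finally show "emeasure (distr lborel lborel vec_to_copy) (box l u) = (\<Prod>b\<in>Basis. (u - l) \<bullet> b)"
    .
qed simp

lemma absolutely_integrable_on_UNIV_iff_lborel:
  fixes f :: "'a::euclidean_space \<Rightarrow> real"
  assumes "f \<in> borel_measurable borel"
  shows "f absolutely_integrable_on UNIV \<longleftrightarrow> integrable lborel f"
  using integrable_completion[of f lborel] assms by (simp add: set_integrable_def)

lemma lborel_integral_matrix_vector_wellorder:
  fixes A :: "real^'m::{finite,wellorder}^'m::_" and f :: "real^'m::_ \<Rightarrow> real"
  assumes A: "invertible A" and f [measurable]: "f \<in> borel_measurable borel"
  shows "integrable lborel (\<lambda>x. f (A *v x)) \<longleftrightarrow> integrable lborel f" (is ?int)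
    and "(LINT x|lborel. f (A *v x)) = (LINT y|lborel. f y) / \<bar>det A\<bar>"
proof -
  have det: "det A \<noteq> 0"
    using A invertible_det_nz by blast
  obtain B where B: "A ** B = mat 1" "B ** A = mat 1"
    using A unfolding invertible_def by blast
  have cov: "(\<lambda>x. \<bar>det A\<bar> * f (A *v x)) absolutely_integrable_on UNIV
      \<and> integral UNIV (\<lambda>x. \<bar>det A\<bar> * f (A *v x)) = b
    \<longleftrightarrow> f absolutely_integrable_on UNIV \<and> integral UNIV f = b" for b
    using cov_invertible_real[where g'="\<lambda>_. (*v) A" and h="(*v) B" and h'="\<lambda>_. (*v) B" and f=f]
    by (simp add: matrix_of_matrix_vector_mul linear_imp_has_derivative matrix_vector_mul_assoc B
        fun_eq_iff)
  have "(\<lambda>x. f (A *v x)) absolutely_integrable_on UNIV \<longleftrightarrow> f absolutely_integrable_on UNIV"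
    using cov det
      absolutely_integrable_on_scaleR_iff[where c="\<bar>det A\<bar>" and f="\<lambda>x. f (A *v x)" and S=UNIV]
    by auto
  then show int: ?int
    by (simp add: absolutely_integrable_on_UNIV_iff_lborel)
  show "(LINT x|lborel. f (A *v x)) = (LINT y|lborel. f y) / \<bar>det A\<bar>"
  proof (cases "integrable lborel f")
    case True
    then have "integral UNIV (\<lambda>x. \<bar>det A\<bar> * f (A *v x)) = integral UNIV f"
      using cov[of "integral UNIV f"] absolutely_integrable_on_UNIV_iff_lborel[OF f] by blast
    with True int det show ?thesis
      by (simp add: integral_lborel field_simps)
  next
    case False
    with int show ?thesis
      by (simp add: not_integrable_integral_eq)
  qed
qed

lemma lborel_integral_vec_from_copy:
  fixes f :: "real^'n \<Rightarrow> real"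
  assumes [measurable]: "f \<in> borel_measurable borel"
  shows "integrable lborel (\<lambda>y. f (vec_from_copy y)) \<longleftrightarrow> integrable lborel f"
    and "(LINT y|lborel. f (vec_from_copy y)) = (LINT x|lborel. f x)"
  using integrable_distr_eq[of vec_to_copy lborel lborel "\<lambda>y. f (vec_from_copy y)"]
    integral_distr[of vec_to_copy lborel lborel "\<lambda>y. f (vec_from_copy y)"]
  by (simp_all add: distr_lborel_vec_to_copy)

lemma
  fixes A :: "real^'n^'n" and f :: "real^'n \<Rightarrow> real"
  assumes A: "invertible A" and f [measurable]: "f \<in> borel_measurable borel"
  shows lborel_integrable_matrix_vector_iff:
      "integrable lborel (\<lambda>x. f (A *v x)) \<longleftrightarrow> integrable lborel f"
    and lborel_integral_matrix_vector:
      "(LINT x|lborel. f (A *v x)) = (LINT y|lborel. f y) / \<bar>det A\<bar>"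
proof -
  have "f (A *v vec_from_copy y) = f (vec_from_copy (mat_to_copy A *v y))" for y
    by (metis vec_from_to_copy vec_to_copy_matrix_vector_mult vec_to_from_copy)
  then have shift:
      "(\<lambda>y. f (A *v vec_from_copy y)) = (\<lambda>y. (f \<circ> vec_from_copy) (mat_to_copy A *v y))"
    by (simp add: o_def)
  note cov = lborel_integral_matrix_vector_wellorder[OF invertible_mat_to_copy[OF A],
      of "f \<circ> vec_from_copy"]
  note transport = lborel_integral_vec_from_copy[of "\<lambda>x. f (A *v x)"] lborel_integral_vec_from_copy[of f]
  show "integrable lborel (\<lambda>x. f (A *v x)) \<longleftrightarrow> integrable lborel f"
    using transport cov(1) shift by (simp add: o_def)
  show "(LINT x|lborel. f (A *v x)) = (LINT y|lborel. f y) / \<bar>det A\<bar>"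
    using transport cov(2) shift by (simp add: o_def det_mat_to_copy)
qed

section \<open>Gaussian integrals\<close>

definition std_gauss :: "real^'n \<Rightarrow> real" where
  "std_gauss y = exp (- (norm y)\<^sup>2 / 2)"

lemma gauss_eq_std_gauss: "gauss \<phi> x = std_gauss (\<phi> *v x)"
  by (simp add: gauss_def std_gauss_def)

lemma std_gauss_pos [simp]: "0 < std_gauss y"
  by (simp add: std_gauss_def)

lemma borel_measurable_std_gauss [measurable]: "std_gauss \<in> borel_measurable borel"
  unfolding std_gauss_def by measurable

lemma continuous_on_std_gauss: "continuous_on UNIV std_gauss"
  unfolding std_gauss_def by (intro continuous_intros) auto

lemma std_gauss_eq_prod: "std_gauss (x::real^'n) = (\<Prod>b\<in>Basis. exp (- (x \<bullet> b)\<^sup>2 / 2))"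
proof -
  have "(norm x)\<^sup>2 = (\<Sum>b\<in>Basis. (x \<bullet> b)\<^sup>2)"
    unfolding power2_norm_eq_inner by (simp add: euclidean_inner[of x x] power2_eq_square)
  then have "- (norm x)\<^sup>2 / 2 = (\<Sum>b\<in>Basis. - (x \<bullet> b)\<^sup>2 / 2)"
    by (simp add: sum_divide_distrib sum_negf)
  then show ?thesis
    by (simp add: std_gauss_def exp_sum)
qed

lemma nn_integral_std_gauss:
  "(\<integral>\<^sup>+x. std_gauss (x::real^'n) \<partial>lborel) = ennreal (sqrt (2 * pi) ^ CARD('n))"
proof -
  have "(\<integral>\<^sup>+t. exp (- t\<^sup>2 / 2) \<partial>lborel) = (\<integral>\<^sup>+t. sqrt (2 * pi) * std_normal_density t \<partial>lborel)"
    by (simp add: std_normal_density_def)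
  also have "\<dots> = ennreal (sqrt (2 * pi))"
    by (subst nn_integral_eq_integral) auto
  finally have one_dim: "(\<integral>\<^sup>+t. exp (- t\<^sup>2 / 2) \<partial>lborel) = ennreal (sqrt (2 * pi))" .
  have "(\<integral>\<^sup>+x. std_gauss (x::real^'n) \<partial>lborel)
      = (\<integral>\<^sup>+x. (\<Prod>b\<in>Basis. ennreal (exp (- ((x::real^'n) \<bullet> b)\<^sup>2 / 2))) \<partial>lborel)"
    by (simp add: std_gauss_eq_prod prod_ennreal)
  also have "\<dots> = (\<Prod>b\<in>(Basis::(real^'n) set). \<integral>\<^sup>+t. exp (- t\<^sup>2 / 2) \<partial>lborel)"
    by (rule nn_integral_lborel_prod) auto
  also have "\<dots> = ennreal (sqrt (2 * pi) ^ CARD('n))"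
    using one_dim by (simp add: prod_Basis_vec ennreal_power)
  finally show ?thesis .
qed

lemma integrable_std_gauss: "integrable lborel (std_gauss :: real^'n \<Rightarrow> real)"
  by (rule integrableI_nonneg) (auto simp: less_imp_le nn_integral_std_gauss)

lemma integral_std_gauss: "(LINT x|lborel. std_gauss (x::real^'n)) = sqrt (2 * pi) ^ CARD('n)"
proof -
  have "ennreal (LINT x|lborel. std_gauss (x::real^'n)) = ennreal (sqrt (2 * pi) ^ CARD('n))"
    using integrable_std_gauss
    by (subst nn_integral_eq_integral[symmetric]) (auto simp: less_imp_le nn_integral_std_gauss)
  then show ?thesis
    by (simp add: integral_nonneg_AE less_imp_le)
qed

lemma
  fixes B :: "real^'n^'n"
  assumes "invertible B"
  shows integrable_std_gauss_matrix: "integrable lborel (\<lambda>y. std_gauss (B *v y))"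
    and integral_std_gauss_matrix:
      "(LINT y|lborel. std_gauss (B *v y)) = sqrt (2 * pi) ^ CARD('n) / \<bar>det B\<bar>"
  using lborel_integrable_matrix_vector_iff[OF assms, of std_gauss]
    lborel_integral_matrix_vector[OF assms, of std_gauss]
  by (simp_all add: integrable_std_gauss integral_std_gauss)

lemma invertible_scaleR_mat_1: "c \<noteq> 0 \<Longrightarrow> invertible (c *\<^sub>R (mat 1 :: real^'n^'n))"
  by (simp add: invertible_det_nz det_diagonal mat_def)

lemma det_scaleR_mat_1: "det (c *\<^sub>R (mat 1 :: real^'n^'n)) = c ^ CARD('n)"
  by (simp add: det_diagonal mat_def)

lemma norm_sq_std_gauss_le: "(norm y)\<^sup>2 * std_gauss y \<le> 4 * std_gauss ((1 / sqrt 2) *\<^sub>R y)"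
proof -
  \<comment> \<open>With \<open>s = |y|\<^sup>2 / 4\<close> this is \<open>4 s e\<^sup>-\<^sup>s \<le> 4\<close>.\<close>
  define s where "s = (norm y)\<^sup>2 / 4"
  have "s \<le> exp s"
    using exp_ge_add_one_self[of s] by linarith
  then have s_exp: "s * exp (- s) \<le> 1"
    by (simp add: exp_minus field_simps)
  have "(norm y)\<^sup>2 * std_gauss y = 4 * (s * exp (- s)) * exp (- s)"
    by (simp add: std_gauss_def s_def flip: exp_add)
  also have "\<dots> \<le> 4 * exp (- s)"
    using s_exp by simp
  also have "\<dots> = 4 * std_gauss ((1 / sqrt 2) *\<^sub>R y)"
    by (simp add: std_gauss_def s_def power_divide)
  finally show ?thesis .
qed

lemma integrable_norm_sq_std_gauss: "integrable lborel (\<lambda>y::real^'n. (norm y)\<^sup>2 * std_gauss y)"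
proof (rule Bochner_Integration.integrable_bound)
  have "integrable lborel (\<lambda>y::real^'n. std_gauss (((1 / sqrt 2) *\<^sub>R mat 1) *v y))"
    by (simp add: integrable_std_gauss_matrix invertible_scaleR_mat_1)
  then show "integrable lborel (\<lambda>y::real^'n. 4 * std_gauss ((1 / sqrt 2) *\<^sub>R y))"
    by (simp add: scaleR_matrix_vector_assoc[symmetric])
  show "AE y in lborel.
      norm ((norm y)\<^sup>2 * std_gauss y) \<le> norm (4 * std_gauss ((1 / sqrt 2) *\<^sub>R y))"
    by (intro AE_I2) (simp add: abs_mult abs_of_pos norm_sq_std_gauss_le)
qed simp

lemma integrable_dominated_norm_sq_std_gauss:
  fixes h :: "real^'n \<Rightarrow> real"
  assumes [measurable]: "h \<in> borel_measurable borel"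
    and "\<And>y. \<bar>h y\<bar> \<le> C * ((norm y)\<^sup>2 * std_gauss y)"
  shows "integrable lborel h"
proof (rule Bochner_Integration.integrable_bound)
  show "integrable lborel (\<lambda>y. C * ((norm y)\<^sup>2 * std_gauss y))"
    by (rule integrable_mult_right[OF integrable_norm_sq_std_gauss])
  show "AE y in lborel. norm (h y) \<le> norm (C * ((norm y)\<^sup>2 * std_gauss y))"
    using assms(2) by (intro AE_I2) (metis abs_ge_self order_trans real_norm_def)
qed simp

lemma matrix_vector_mult_norm_sq_bound:
  fixes B :: "real^'n^'m"
  obtains C where "\<And>y. (norm (B *v y))\<^sup>2 \<le> C * (norm y)\<^sup>2"
proof -
  obtain K where K: "\<And>y. norm (B *v y) \<le> norm y * K"
    using bounded_linear.pos_bounded[OF matrix_vector_mul_bounded_linear[of B]] by blast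
  have "(norm (B *v y))\<^sup>2 \<le> K\<^sup>2 * (norm y)\<^sup>2" for y
    using power_mono[OF K[of y], of 2] by (simp add: power_mult_distrib mult.commute)
  then show ?thesis using that by blast
qed

definition quad_moment :: "real^'n^'n \<Rightarrow> real" where
  "quad_moment B = (LINT y|lborel. (norm (B *v y))\<^sup>2 / 2 * std_gauss y)"

lemma integrable_quad_moment:
  fixes B :: "real^'n^'m"
  shows "integrable lborel (\<lambda>y. (norm (B *v y))\<^sup>2 / 2 * std_gauss y)"
proof -
  obtain C where C: "\<And>y. (norm (B *v y))\<^sup>2 \<le> C * (norm y)\<^sup>2"
    using matrix_vector_mult_norm_sq_bound[of B] by blast
  show ?thesis
  proof (rule integrable_dominated_norm_sq_std_gauss[where C = C])
    fix y
    show "\<bar>(norm (B *v y))\<^sup>2 / 2 * std_gauss y\<bar> \<le> C * ((norm y)\<^sup>2 * std_gauss y)"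
    proof -
      have "(norm (B *v y))\<^sup>2 / 2 \<le> C * (norm y)\<^sup>2"
        using C[of y] zero_le_power2[of "norm (B *v y)"] by linarith
      then show ?thesis
        using mult_right_mono[of _ _ "std_gauss y"] by (simp add: abs_mult abs_of_pos less_imp_le)
    qed
  qed simp
qed

section \<open>The tangent inequality\<close>

lemma exp_tangent_le: "exp (- a) * (1 + a - b) \<le> exp (- b :: real)"
proof -
  have "exp (- a) * (1 + a - b) \<le> exp (- a) * exp (a - b)"
    using exp_ge_add_one_self[of "a - b"] by (intro mult_left_mono) (linarith, simp)
  also have "\<dots> = exp (- b)"
    by (simp flip: exp_add)
  finally show ?thesis .
qed

lemma exp_tangent_eq_imp_eq:
  assumes "exp (- a) * (1 + a - b) = exp (- b :: real)"
  shows "a = b"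
proof -
  have e: "exp (a - b) = 1 + (a - b)"
    using assms by (simp add: exp_diff exp_minus field_simps)
  have "ln (exp (a - b)) = exp (a - b) - 1"
    unfolding ln_exp using e by linarith
  then have "exp (a - b) = 1"
    by (intro ln_eq_minus_one) auto
  then show ?thesis
    by simp
qed

text \<open>\<open>std_gauss y * (1 + a - b)\<close> is the tangent of \<open>exp\<close> at \<open>-a\<close>, evaluated at \<open>-b\<close>,
  for \<open>a = |y|\<^sup>2/2\<close> and \<open>b = |B y|\<^sup>2/2\<close>.\<close>
definition gauss_defect :: "real^'n^'n \<Rightarrow> real^'n \<Rightarrow> real" where
  "gauss_defect B y =
    std_gauss (B *v y) - std_gauss y * (1 + (norm y)\<^sup>2 / 2 - (norm (B *v y))\<^sup>2 / 2)"

lemma gauss_defect_nonneg: "0 \<le> gauss_defect B y"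
  using exp_tangent_le[of "(norm y)\<^sup>2 / 2" "(norm (B *v y))\<^sup>2 / 2"]
  by (simp add: gauss_defect_def std_gauss_def)

lemma gauss_defect_eq_0_imp:
  assumes "gauss_defect B y = 0"
  shows "norm (B *v y) = norm y"
proof -
  have "(norm y)\<^sup>2 / 2 = (norm (B *v y))\<^sup>2 / 2"
    by (rule exp_tangent_eq_imp_eq) (use assms in \<open>simp add: gauss_defect_def std_gauss_def\<close>)
  then have "(norm (B *v y))\<^sup>2 = (norm y)\<^sup>2"
    by simp
  then show ?thesis
    by (rule power2_eq_imp_eq) simp_all
qed

lemma continuous_on_gauss_defect: "continuous_on UNIV (gauss_defect B)"
  unfolding gauss_defect_def[abs_def]
  by (intro continuous_intros continuous_on_compose2[OF continuous_on_std_gauss]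
      linear_continuous_on) (auto simp: linear_linear)

lemma
  fixes B :: "real^'n^'n"
  assumes "invertible B"
  shows integrable_gauss_defect: "integrable lborel (gauss_defect B)"
    and integral_gauss_defect: "(LINT y|lborel. gauss_defect B y)
      = sqrt (2 * pi) ^ CARD('n) / \<bar>det B\<bar> - sqrt (2 * pi) ^ CARD('n)
        - quad_moment (mat 1 :: real^'n^'n) + quad_moment B"
proof -
  let ?G = "\<lambda>y. std_gauss y + ((norm (mat 1 *v y))\<^sup>2 / 2 * std_gauss y
    - (norm (B *v y))\<^sup>2 / 2 * std_gauss y)"
  have expand: "gauss_defect B = (\<lambda>y. std_gauss (B *v y) - ?G y)"
    by (simp add: gauss_defect_def algebra_simps fun_eq_iff)
  have int_G: "integrable lborel ?G"
    by (intro Bochner_Integration.integrable_add Bochner_Integration.integrable_diff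
        integrable_std_gauss integrable_quad_moment)
  show "integrable lborel (gauss_defect B)"
    unfolding expand
    by (intro Bochner_Integration.integrable_diff int_G integrable_std_gauss_matrix[OF assms])
  show "(LINT y|lborel. gauss_defect B y)
      = sqrt (2 * pi) ^ CARD('n) / \<bar>det B\<bar> - sqrt (2 * pi) ^ CARD('n)
        - quad_moment (mat 1 :: real^'n^'n) + quad_moment B"
    unfolding expand quad_moment_def
    by (simp only: Bochner_Integration.integral_diff[OF integrable_std_gauss_matrix[OF assms] int_G]
        Bochner_Integration.integral_add[OF integrable_std_gauss Bochner_Integration.integrable_diff]
        Bochner_Integration.integral_diff[OF integrable_quad_moment integrable_quad_moment]
        integrable_quad_moment integral_std_gauss_matrix[OF assms] integral_std_gauss)
qed

lemma quad_moment_tangent_bound: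
  fixes B :: "real^'n^'n"
  assumes "invertible B"
  shows "sqrt (2 * pi) ^ CARD('n) + quad_moment (mat 1 :: real^'n^'n) - quad_moment B
    \<le> sqrt (2 * pi) ^ CARD('n) / \<bar>det B\<bar>"
proof -
  have "0 \<le> (LINT y|lborel. gauss_defect B y)"
    by (intro integral_nonneg_AE AE_I2 gauss_defect_nonneg)
  then show ?thesis
    using integral_gauss_defect[OF assms] by linarith
qed

lemma quad_moment_scaleR_mat_1:
  "quad_moment (c *\<^sub>R mat 1 :: real^'n^'n) = c\<^sup>2 * quad_moment (mat 1 :: real^'n^'n)"
proof -
  have "(norm ((c *\<^sub>R mat 1) *v y))\<^sup>2 / 2 * std_gauss y
      = c\<^sup>2 * ((norm (mat 1 *v y))\<^sup>2 / 2 * std_gauss y)" for y :: "real^'n"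
    by (simp add: scaleR_matrix_vector_assoc[symmetric] power_mult_distrib)
  then show ?thesis
    unfolding quad_moment_def by (simp only: integral_mult_right_zero)
qed

text \<open>Applied to \<open>B = \<surd>s \<cdot> I\<close> the tangent bound says that
  \<open>F s = K s\<^sup>-\<^sup>n\<^sup>/\<^sup>2 - K + (s - 1) M\<close> is nonnegative; since \<open>F 1 = 0\<close>, also \<open>F' 1 = 0\<close>.\<close>
lemma quad_moment_mat_1:
  "quad_moment (mat 1 :: real^'n^'n) = real CARD('n) / 2 * sqrt (2 * pi) ^ CARD('n)"
proof -
  define K where "K = sqrt (2 * pi) ^ CARD('n)"
  define M where "M = quad_moment (mat 1 :: real^'n^'n)"
  define n where "n = real CARD('n)"
  define F where "F s = K * s powr (- (n / 2)) - K + (s - 1) * M" for s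
  have F_nonneg: "0 \<le> F s" if "0 < s" for s
  proof -
    have "K + M - s * M \<le> K / sqrt s ^ CARD('n)"
      using quad_moment_tangent_bound[OF invertible_scaleR_mat_1[of "sqrt s", where 'n='n]] that
      by (simp add: K_def M_def quad_moment_scaleR_mat_1 det_scaleR_mat_1)
    moreover have "sqrt s ^ CARD('n) = s powr (n / 2)"
      using that by (simp add: n_def powr_half_sqrt[symmetric] powr_realpow[symmetric] powr_powr)
    ultimately show ?thesis
      using that by (simp add: F_def powr_minus_divide algebra_simps)
  qed
  have "(F has_real_derivative K * (- (n / 2) * 1 powr (- (n / 2) - 1)) + M) (at 1)"
    unfolding F_def by (auto intro!: derivative_eq_intros)
  then have "K * (- (n / 2) * 1 powr (- (n / 2) - 1)) + M = 0"
    by (rule DERIV_local_min[where d = 1]) (use F_nonneg in \<open>auto simp: F_def\<close>)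
  then show ?thesis
    by (simp add: K_def M_def n_def)
qed

lemma continuous_nonneg_integral_eq_0_imp_zero:
  fixes f :: "'a::euclidean_space \<Rightarrow> real"
  assumes cont: "continuous_on UNIV f" and int: "integrable lborel f"
    and nonneg: "\<And>x. 0 \<le> f x" and zero: "(LINT x|lborel. f x) = 0"
  shows "f x = 0"
proof (rule ccontr)
  assume "f x \<noteq> 0"
  then have "x \<in> {y. 0 < f y}"
    using nonneg[of x] by simp
  moreover have "open {y. 0 < f y}"
    using open_Collect_less[of "\<lambda>_. 0" f] cont by simp
  ultimately obtain r where r: "0 < r" "ball x r \<subseteq> {y. 0 < f y}"
    by (meson open_contains_ball)
  have f_borel [measurable]: "f \<in> borel_measurable borel"
    using cont by (rule borel_measurable_continuous_onI)
  have "AE y in lborel. f y = 0"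
    using integral_nonneg_eq_0_iff_AE[OF int] nonneg zero by simp
  then have "AE y in lborel. y \<notin> ball x r"
    by eventually_elim (use r in force)
  then have "emeasure lborel (ball x r) = 0"
    by (subst (asm) AE_iff_measurable[where N = "ball x r"]) auto
  moreover have "0 < measure lborel (ball x r)"
    using content_ball_pos[OF r(1), of x] by simp
  ultimately show False
    by (simp add: measure_def)
qed

lemma
  fixes B :: "real^'n^'n"
  assumes B: "invertible B" and moment: "quad_moment B \<le> quad_moment (mat 1 :: real^'n^'n)"
  shows abs_det_le_1_of_quad_moment_le: "\<bar>det B\<bar> \<le> 1"
    and norm_preserving_of_quad_moment_le: "\<bar>det B\<bar> = 1 \<Longrightarrow> norm (B *v y) = norm y"
proof -
  define K where "K = sqrt (2 * pi) ^ CARD('n)"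
  have K: "0 < K"
    by (simp add: K_def)
  have det: "0 < \<bar>det B\<bar>"
    using B invertible_det_nz by auto
  have "K \<le> K / \<bar>det B\<bar>"
    using quad_moment_tangent_bound[OF B] moment unfolding K_def by linarith
  then have "K * \<bar>det B\<bar> \<le> K * 1"
    using det by (simp add: le_divide_eq)
  then show "\<bar>det B\<bar> \<le> 1"
    using mult_le_cancel_left_pos[OF K] by blast
  assume "\<bar>det B\<bar> = 1"
  then have "(LINT y|lborel. gauss_defect B y) = quad_moment B - quad_moment (mat 1 :: real^'n^'n)"
    using integral_gauss_defect[OF B] by simp
  moreover have "0 \<le> (LINT y|lborel. gauss_defect B y)"
    by (intro integral_nonneg_AE AE_I2 gauss_defect_nonneg)
  ultimately have "(LINT y|lborel. gauss_defect B y) = 0"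
    using moment by linarith
  then have "gauss_defect B y = 0"
    by (rule continuous_nonneg_integral_eq_0_imp_zero[OF continuous_on_gauss_defect
        integrable_gauss_defect[OF B] gauss_defect_nonneg])
  then show "norm (B *v y) = norm y"
    by (rule gauss_defect_eq_0_imp)
qed

section \<open>\<open>L\<^sub>p\<close> moments\<close>

definition lp_moment :: "real \<Rightarrow> real^'n^'n \<Rightarrow> real" where
  "lp_moment p B = (LINT y|lborel.
    ((norm (B *v y))\<^sup>2 / 2) powr p * ((norm y)\<^sup>2 / 2) powr (1 - p) * std_gauss y)"

lemma lp_moment_mat_1: "lp_moment p (mat 1 :: real^'n^'n) = quad_moment (mat 1 :: real^'n^'n)"
proof -
  have "a powr p * a powr (1 - p) = a" if "0 \<le> a" for a :: real
    using that by (cases "a = 0") (simp_all flip: powr_add)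
  then show ?thesis
    by (simp add: lp_moment_def quad_moment_def)
qed

lemma bernoulli_powr:
  fixes p t :: real
  assumes p: "1 \<le> p" and t: "0 \<le> t"
  shows "1 + p * (t - 1) \<le> t powr p"
proof (cases "t = 0")
  case True
  then show ?thesis
    using p by simp
next
  case False
  then have "t \<le> 1 / p * t powr p + (1 - 1 / p)"
    using Youngs_inequality_0[of "1 / p" "1 - 1 / p" "t powr p" 1] p t
    by (simp add: powr_powr)
  then have "p * t \<le> p * (1 / p * t powr p + (1 - 1 / p))"
    using p by (intro mult_left_mono) auto
  then show ?thesis
    using p by (simp add: algebra_simps)
qed

lemma tangent_le_powr_mult:
  fixes a b p :: real
  assumes p: "1 \<le> p" and a: "0 < a" and b: "0 \<le> b"
  shows "a + p * (b - a) \<le> b powr p * a powr (1 - p)"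
proof -
  have "a * (1 + p * (b / a - 1)) \<le> a * (b / a) powr p"
    using bernoulli_powr[OF p, of "b / a"] a b by (intro mult_left_mono) auto
  moreover have "a * (1 + p * (b / a - 1)) = a + p * (b - a)"
    using a by (simp add: field_simps)
  moreover have "a * (b / a) powr p = b powr p * a powr (1 - p)"
    using a b by (simp add: powr_divide powr_diff)
  ultimately show ?thesis
    by simp
qed

lemma powr_mult_le_of_le:
  fixes a b p C :: real
  assumes p: "0 \<le> p" and a: "0 < a" and b: "0 \<le> b" and ba: "b \<le> C * a"
  shows "b powr p * a powr (1 - p) \<le> C powr p * a"
proof -
  have "0 \<le> C * a"
    using b ba by linarith
  then have C: "0 \<le> C"
    using a by (simp add: zero_le_mult_iff)
  have "b powr p \<le> (C * a) powr p"
    using p b ba by (intro powr_mono2) auto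
  then have "b powr p * a powr (1 - p) \<le> C powr p * a powr p * a powr (1 - p)"
    using C a by (simp add: powr_mult mult_right_mono)
  also have "\<dots> = C powr p * a"
    using a by (simp add: mult.assoc flip: powr_add)
  finally show ?thesis .
qed

lemma integrable_lp_moment:
  fixes B :: "real^'n^'n"
  assumes "0 \<le> p"
  shows "integrable lborel
    (\<lambda>y. ((norm (B *v y))\<^sup>2 / 2) powr p * ((norm y)\<^sup>2 / 2) powr (1 - p) * std_gauss y)"
proof -
  obtain C where C: "\<And>y. (norm (B *v y))\<^sup>2 \<le> C * (norm y)\<^sup>2"
    using matrix_vector_mult_norm_sq_bound[of B] by blast
  show ?thesis
  proof (rule integrable_dominated_norm_sq_std_gauss[where C = "C powr p / 2"])
    fix y :: "real^'n"
    show "\<bar>((norm (B *v y))\<^sup>2 / 2) powr p * ((norm y)\<^sup>2 / 2) powr (1 - p) * std_gauss y\<bar>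
      \<le> C powr p / 2 * ((norm y)\<^sup>2 * std_gauss y)"
    proof (cases "y = 0")
      case False
      then have "((norm (B *v y))\<^sup>2 / 2) powr p * ((norm y)\<^sup>2 / 2) powr (1 - p)
          \<le> C powr p * ((norm y)\<^sup>2 / 2)"
        using C[of y] assms by (intro powr_mult_le_of_le) auto
      then show ?thesis
        using mult_right_mono[of _ _ "std_gauss y"] by (simp add: abs_mult abs_of_pos less_imp_le)
    qed simp
  qed simp
qed

lemma quad_moment_le_lp_moment:
  fixes B :: "real^'n^'n"
  assumes p: "1 \<le> p"
  shows "quad_moment (mat 1 :: real^'n^'n) + p * (quad_moment B - quad_moment (mat 1 :: real^'n^'n))
    \<le> lp_moment p B"
proof -
  let ?a = "\<lambda>y::real^'n. (norm (mat 1 *v y))\<^sup>2 / 2 * std_gauss y"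
  let ?b = "\<lambda>y. (norm (B *v y))\<^sup>2 / 2 * std_gauss y"
  have "(LINT y|lborel. (1 - p) * ?a y + p * ?b y) \<le> lp_moment p B"
    unfolding lp_moment_def
  proof (rule integral_mono)
    show "integrable lborel (\<lambda>y. (1 - p) * ?a y + p * ?b y)"
      by (intro Bochner_Integration.integrable_add integrable_mult_right integrable_quad_moment)
    show "integrable lborel
        (\<lambda>y. ((norm (B *v y))\<^sup>2 / 2) powr p * ((norm y)\<^sup>2 / 2) powr (1 - p) * std_gauss y)"
      using p by (intro integrable_lp_moment) simp
  next
    fix y :: "real^'n"
    show "(1 - p) * ?a y + p * ?b y
      \<le> ((norm (B *v y))\<^sup>2 / 2) powr p * ((norm y)\<^sup>2 / 2) powr (1 - p) * std_gauss y"
    proof (cases "y = 0")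
      case False
      then have "(norm y)\<^sup>2 / 2 + p * ((norm (B *v y))\<^sup>2 / 2 - (norm y)\<^sup>2 / 2)
          \<le> ((norm (B *v y))\<^sup>2 / 2) powr p * ((norm y)\<^sup>2 / 2) powr (1 - p)"
        using p by (intro tangent_le_powr_mult) auto
      from mult_right_mono[OF this, of "std_gauss y"] show ?thesis
        by (simp add: algebra_simps less_imp_le add_divide_distrib diff_divide_distrib)
    qed simp
  qed
  moreover have "(LINT y|lborel. (1 - p) * ?a y + p * ?b y)
      = (1 - p) * quad_moment (mat 1 :: real^'n^'n) + p * quad_moment B"
    unfolding quad_moment_def
    by (simp only: Bochner_Integration.integral_add[OF integrable_mult_right integrable_mult_right]
        integrable_quad_moment integral_mult_right_zero)
  ultimately show ?thesis
    by (simp add: algebra_simps)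
qed

section \<open>Gaussian functions\<close>

lemma
  fixes A :: "'a::field^'n^'n"
  assumes "invertible A"
  shows matrix_inv_right: "A ** matrix_inv A = mat 1"
    and matrix_inv_left: "matrix_inv A ** A = mat 1"
  using someI_ex[OF assms[unfolded invertible_def]] by (simp_all add: matrix_inv_def)

lemma domf_gauss: "domf (gauss \<psi>) = UNIV"
  by (simp add: domf_def gauss_def)

lemma pot_gauss: "pot (gauss \<psi>) = (\<lambda>x. (norm (\<psi> *v x))\<^sup>2 / 2)"
  by (simp add: pot_def gauss_def fun_eq_iff)

lemma inner_matrix_vector_transpose: "x \<bullet> (transpose A *v z) = (A *v x) \<bullet> (z :: real^'n)"
  by (metis dot_lmul_matrix inner_commute transpose_matrix_vector)

text \<open>Completing the square: \<open>\<langle>x, y\<rangle> - |\<psi> x|\<^sup>2/2 = |z|\<^sup>2/2 - |\<psi> x - z|\<^sup>2/2\<close>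
  with \<open>z = \<psi>\<^sup>-\<^sup>T y\<close>, and the last term vanishes at \<open>x = \<psi>\<^sup>-\<^sup>1 z\<close>.\<close>
lemma supp_fun_gauss:
  fixes \<psi> :: "real^'n^'n"
  assumes \<psi>: "invertible \<psi>"
  shows "supp_fun (gauss \<psi>) y = (norm (transpose (matrix_inv \<psi>) *v y))\<^sup>2 / 2"
proof -
  define z where "z = transpose (matrix_inv \<psi>) *v y"
  have y: "y = transpose \<psi> *v z"
    by (simp only: z_def matrix_vector_mul_assoc matrix_transpose_mul[symmetric]
        matrix_inv_left[OF \<psi>] transpose_mat matrix_vector_mul_lid)
  have square: "x \<bullet> y - (norm (\<psi> *v x))\<^sup>2 / 2 = (norm z)\<^sup>2 / 2 - (norm (\<psi> *v x - z))\<^sup>2 / 2" for x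
    unfolding y inner_matrix_vector_transpose
    by (simp add: power2_norm_eq_inner inner_diff_left inner_diff_right inner_commute field_simps)
  have at_max: "\<psi> *v (matrix_inv \<psi> *v z) = z"
    by (simp add: matrix_vector_mul_assoc matrix_inv_right[OF \<psi>])
  have "supp_fun (gauss \<psi>) y = (SUP x. x \<bullet> y - (norm (\<psi> *v x))\<^sup>2 / 2)"
    by (simp add: supp_fun_def domf_gauss pot_gauss)
  also have "\<dots> = (norm z)\<^sup>2 / 2"
  proof (rule cSup_eq_maximum)
    show "(norm z)\<^sup>2 / 2 \<in> range (\<lambda>x. x \<bullet> y - (norm (\<psi> *v x))\<^sup>2 / 2)"
      using square[of "matrix_inv \<psi> *v z"] at_max
      by (intro range_eqI[of _ _ "matrix_inv \<psi> *v z"]) simp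
  qed (auto simp: square)
  finally show ?thesis
    by (simp add: z_def)
qed

lemma GDERIV_unique:
  assumes "GDERIV f x :> D" and "GDERIV f x :> E"
  shows "D = E"
proof -
  have "(\<lambda>h. h \<bullet> D) = (\<lambda>h. h \<bullet> E)"
    using assms unfolding gderiv_def by (rule has_derivative_unique)
  from fun_cong[OF this, of "D - E"] have "(D - E) \<bullet> (D - E) = 0"
    by (simp add: inner_diff_right)
  then show ?thesis
    by simp
qed

lemma GDERIV_pot_gauss: "GDERIV (pot (gauss \<phi>)) x :> transpose \<phi> *v (\<phi> *v x)"
proof -
  have "((\<lambda>x. (\<phi> *v x) \<bullet> (\<phi> *v x) / 2) has_derivative
      (\<lambda>h. ((\<phi> *v h) \<bullet> (\<phi> *v x) + (\<phi> *v x) \<bullet> (\<phi> *v h)) / 2)) (at x)"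
    by (auto intro!: derivative_eq_intros
        bounded_linear.has_derivative[OF matrix_vector_mul_bounded_linear])
  moreover have "(\<lambda>h. ((\<phi> *v h) \<bullet> (\<phi> *v x) + (\<phi> *v x) \<bullet> (\<phi> *v h)) / 2)
      = (\<lambda>h. h \<bullet> (transpose \<phi> *v (\<phi> *v x)))"
    by (simp only: inner_matrix_vector_transpose) (simp add: inner_commute)
  ultimately show ?thesis
    by (simp only: gderiv_def pot_gauss power2_norm_eq_inner)
qed

lemma grad_pot_gauss: "grad_pot (gauss \<phi>) x = transpose \<phi> *v (\<phi> *v x)"
  unfolding grad_pot_def using GDERIV_pot_gauss by (blast intro: GDERIV_unique)

lemma Jf_gauss:
  fixes \<psi> :: "real^'n^'n"
  assumes "invertible \<psi>"
  shows "Jf (gauss \<psi>) = sqrt (2 * pi) ^ CARD('n) / \<bar>det \<psi>\<bar>"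
  by (simp add: Jf_def gauss_eq_std_gauss integral_std_gauss_matrix[OF assms])

lemma Jdiamond_gauss:
  fixes \<phi> :: "real^'n^'n"
  assumes \<phi>: "invertible \<phi>"
  shows "Jdiamond (gauss \<phi>) = quad_moment (mat 1 :: real^'n^'n) / \<bar>det \<phi>\<bar>"
proof -
  define h where "h y = real CARD('n) * std_gauss y - (norm (mat 1 *v y))\<^sup>2 / 2 * std_gauss y"
    for y :: "real^'n"
  have [measurable]: "h \<in> borel_measurable borel"
    unfolding h_def[abs_def] by measurable
  have "Jdiamond (gauss \<phi>) = (LINT x|lborel. h (\<phi> *v x))"
    by (simp add: Jdiamond_def h_def gauss_eq_std_gauss std_gauss_def algebra_simps)
  also have "\<dots> = (LINT y|lborel. h y) / \<bar>det \<phi>\<bar>"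
    by (rule lborel_integral_matrix_vector[OF \<phi>]) measurable
  also have "(LINT y|lborel. h y)
      = real CARD('n) * sqrt (2 * pi) ^ CARD('n) - quad_moment (mat 1 :: real^'n^'n)"
    unfolding h_def quad_moment_def
    by (simp only: Bochner_Integration.integral_diff[OF integrable_mult_right integrable_quad_moment]
        integrable_std_gauss integral_mult_right_zero integral_std_gauss)
  also have "\<dots> = quad_moment (mat 1 :: real^'n^'n)"
    by (simp add: quad_moment_mat_1)
  finally show ?thesis .
qed

lemma deltaJ_gauss:
  fixes \<phi> \<psi> :: "real^'n^'n"
  assumes \<phi>: "invertible \<phi>" and \<psi>: "invertible \<psi>"
  shows "deltaJ p (gauss \<phi>) (gauss \<psi>)
    = lp_moment p (transpose (\<phi> ** matrix_inv \<psi>)) / (p * \<bar>det \<phi>\<bar>)"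
proof -
  define B where "B = transpose (\<phi> ** matrix_inv \<psi>)"
  define h where "h y = ((norm (B *v y))\<^sup>2 / 2) powr p * ((norm y)\<^sup>2 / 2) powr (1 - p) * std_gauss y"
    for y :: "real^'n"
  have h [measurable]: "h \<in> borel_measurable borel"
    unfolding h_def[abs_def] by measurable
  have grad_\<psi>: "transpose (matrix_inv \<psi>) *v grad_pot (gauss \<phi>) x = B *v (\<phi> *v x)" for x
    by (simp only: B_def grad_pot_gauss matrix_transpose_mul matrix_vector_mul_assoc
        matrix_mul_assoc)
  have grad_\<phi>: "transpose (matrix_inv \<phi>) *v grad_pot (gauss \<phi>) x = \<phi> *v x" for x
    by (simp only: grad_pot_gauss matrix_vector_mul_assoc matrix_mul_assoc
        matrix_transpose_mul[symmetric] matrix_inv_right[OF \<phi>] transpose_mat matrix_mul_lid)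
  have "deltaJ p (gauss \<phi>) (gauss \<psi>) = (1 / p) * (LINT x|lborel. h (\<phi> *v x))"
    unfolding deltaJ_def mu_int_def domf_gauss supp_fun_gauss[OF \<phi>] supp_fun_gauss[OF \<psi>]
      grad_\<psi> grad_\<phi> gauss_eq_std_gauss h_def
    by (simp add: set_lebesgue_integral_def)
  also have "\<dots> = (1 / p) * ((LINT y|lborel. h y) / \<bar>det \<phi>\<bar>)"
    by (simp only: lborel_integral_matrix_vector[OF \<phi> h])
  also have "\<dots> = lp_moment p B / (p * \<bar>det \<phi>\<bar>)"
    by (simp add: lp_moment_def h_def)
  finally show ?thesis
    by (simp add: B_def)
qed

lemma deltaJ_bar_gauss:
  fixes \<phi> \<psi> :: "real^'n^'n"
  assumes "0 < p" and \<phi>: "invertible \<phi>" and \<psi>: "invertible \<psi>"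
  shows "deltaJ_bar p (gauss \<phi>) (gauss \<psi>)
    = (lp_moment p (transpose (\<phi> ** matrix_inv \<psi>)) / quad_moment (mat 1 :: real^'n^'n))
        powr (1 / p)"
proof -
  have "0 < \<bar>det \<phi>\<bar>"
    using \<phi> invertible_det_nz by auto
  then show ?thesis
    using assms(1)
    by (simp add: deltaJ_bar_def deltaJ_gauss[OF \<phi> \<psi>] Jdiamond_gauss[OF \<phi>])
qed

lemma deltaJ_bar_gauss_self:
  fixes \<phi> :: "real^'n^'n"
  assumes "0 < p" and \<phi>: "invertible \<phi>"
  shows "deltaJ_bar p (gauss \<phi>) (gauss \<phi>) = 1"
proof -
  have "0 < quad_moment (mat 1 :: real^'n^'n)"
    by (simp add: quad_moment_mat_1)
  then show ?thesis
    using assms by (simp add: deltaJ_bar_gauss matrix_inv_right lp_moment_mat_1)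
qed

section \<open>Maximality of \<open>\<gamma>\<^sub>\<phi>\<close>\<close>

lemma quad_moment_le_of_deltaJ_bar_le_1:
  fixes \<phi> \<psi> :: "real^'n^'n"
  assumes p: "1 \<le> p" and \<phi>: "invertible \<phi>" and \<psi>: "invertible \<psi>"
    and feasible: "deltaJ_bar p (gauss \<phi>) (gauss \<psi>) \<le> 1"
  shows "quad_moment (transpose (\<phi> ** matrix_inv \<psi>)) \<le> quad_moment (mat 1 :: real^'n^'n)"
proof -
  define B where "B = transpose (\<phi> ** matrix_inv \<psi>)"
  define M where "M = quad_moment (mat 1 :: real^'n^'n)"
  have M: "0 < M"
    by (simp add: M_def quad_moment_mat_1)
  have "(lp_moment p B / M) powr (1 / p) \<le> 1"
    using feasible p by (simp add: deltaJ_bar_gauss \<phi> \<psi> B_def M_def)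
  then have "lp_moment p B / M \<le> 1"
  proof (rule contrapos_pp)
    assume "\<not> lp_moment p B / M \<le> 1"
    then have "1 powr (1 / p) < (lp_moment p B / M) powr (1 / p)"
      using p by (intro powr_less_mono2) auto
    then show "\<not> (lp_moment p B / M) powr (1 / p) \<le> 1"
      by simp
  qed
  then have "M + p * (quad_moment B - M) \<le> M"
    using quad_moment_le_lp_moment[OF p, of B] M by (simp add: M_def divide_le_eq)
  then show ?thesis
    using p by (simp add: B_def M_def mult_le_0_iff)
qed

lemma abs_det_transpose_mult_matrix_inv:
  fixes \<phi> \<psi> :: "real^'n^'n"
  assumes "invertible \<psi>"
  shows "\<bar>det (transpose (\<phi> ** matrix_inv \<psi>))\<bar> = \<bar>det \<phi>\<bar> / \<bar>det \<psi>\<bar>"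
proof -
  have "det (matrix_inv \<psi>) * det \<psi> = 1"
    by (simp flip: det_mul add: matrix_inv_left[OF assms])
  then have "\<bar>det (matrix_inv \<psi>)\<bar> * \<bar>det \<psi>\<bar> = 1"
    by (simp flip: abs_mult)
  then have "\<bar>det (matrix_inv \<psi>)\<bar> = 1 / \<bar>det \<psi>\<bar>"
    by (cases "det \<psi> = 0") (auto simp: eq_divide_eq)
  then show ?thesis
    by (simp add: det_mul abs_mult)
qed

lemma gauss_eq_of_norm_preserving:
  fixes \<phi> \<psi> :: "real^'n^'n"
  assumes \<psi>: "invertible \<psi>"
    and norm: "\<And>y. norm (transpose (\<phi> ** matrix_inv \<psi>) *v y) = norm y"
  shows "gauss \<psi> = gauss \<phi>"
proof -
  define A where "A = \<phi> ** matrix_inv \<psi>"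
  have "orthogonal_matrix (transpose A)"
    using norm orthogonal_transformation_matrix[of "(*v) (transpose A)"]
    by (simp add: A_def orthogonal_transformation matrix_of_matrix_vector_mul)
  then have "orthogonal_transformation ((*v) A)"
    using orthogonal_transformation_matrix[of "(*v) A"]
    by (simp add: matrix_of_matrix_vector_mul)
  moreover have "A *v (\<psi> *v x) = \<phi> *v x" for x
    by (simp add: A_def matrix_vector_mul_assoc matrix_mul_assoc[symmetric] matrix_inv_left[OF \<psi>])
  ultimately have "norm (\<psi> *v x) = norm (\<phi> *v x)" for x
    by (metis orthogonal_transformation)
  then show ?thesis
    by (simp add: gauss_def fun_eq_iff)
qed

lemma Jf_gauss_le_iff:
  fixes \<phi> \<psi> :: "real^'n^'n"
  assumes \<phi>: "invertible \<phi>" and \<psi>: "invertible \<psi>"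
  shows "Jf (gauss \<psi>) \<le> Jf (gauss \<phi>) \<longleftrightarrow> \<bar>det \<phi>\<bar> \<le> \<bar>det \<psi>\<bar>"
proof -
  have "0 < \<bar>det \<phi>\<bar>" "0 < \<bar>det \<psi>\<bar>"
    using \<phi> \<psi> invertible_det_nz by auto
  then show ?thesis
    by (simp add: Jf_gauss \<phi> \<psi> field_simps)
qed

lemma
  fixes \<phi> \<psi> :: "real^'n^'n"
  assumes p: "1 \<le> p" and \<phi>: "invertible \<phi>" and \<psi>: "invertible \<psi>"
    and feasible: "deltaJ_bar p (gauss \<phi>) (gauss \<psi>) \<le> 1"
  shows Jf_gauss_le_of_feasible: "Jf (gauss \<psi>) \<le> Jf (gauss \<phi>)"
    and gauss_eq_of_feasible_Jf_ge: "Jf (gauss \<phi>) \<le> Jf (gauss \<psi>) \<Longrightarrow> gauss \<psi> = gauss \<phi>"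
proof -
  define B where "B = transpose (\<phi> ** matrix_inv \<psi>)"
  have det_\<phi>: "0 < \<bar>det \<phi>\<bar>" and det_\<psi>: "0 < \<bar>det \<psi>\<bar>"
    using \<phi> \<psi> invertible_det_nz by auto
  have det_B: "\<bar>det B\<bar> = \<bar>det \<phi>\<bar> / \<bar>det \<psi>\<bar>"
    unfolding B_def by (rule abs_det_transpose_mult_matrix_inv[OF \<psi>])
  then have "det B \<noteq> 0"
    using det_\<phi> det_\<psi> by auto
  then have B: "invertible B"
    by (simp add: invertible_det_nz)
  have moment: "quad_moment B \<le> quad_moment (mat 1 :: real^'n^'n)"
    unfolding B_def by (rule quad_moment_le_of_deltaJ_bar_le_1[OF p \<phi> \<psi> feasible])
  have "\<bar>det \<phi>\<bar> \<le> \<bar>det \<psi>\<bar>"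
    using abs_det_le_1_of_quad_moment_le[OF B moment] det_\<psi> by (simp add: det_B)
  then show "Jf (gauss \<psi>) \<le> Jf (gauss \<phi>)"
    by (simp add: Jf_gauss_le_iff \<phi> \<psi>)
  assume "Jf (gauss \<phi>) \<le> Jf (gauss \<psi>)"
  then have "\<bar>det \<psi>\<bar> \<le> \<bar>det \<phi>\<bar>"
    by (simp add: Jf_gauss_le_iff \<phi> \<psi>)
  with \<open>\<bar>det \<phi>\<bar> \<le> \<bar>det \<psi>\<bar>\<close> have "\<bar>det B\<bar> = 1"
    using det_\<psi> by (simp add: det_B)
  then show "gauss \<psi> = gauss \<phi>"
    using norm_preserving_of_quad_moment_le[OF B moment]
    by (intro gauss_eq_of_norm_preserving[OF \<psi>]) (simp add: B_def)
qed

theorem corollary3p10: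
  fixes p :: real and \<phi> :: "real^'n^'n"
  assumes "p \<ge> 1" and "invertible \<phi>"
  shows "john_Lp p (gauss \<phi>) = gauss \<phi>"
  unfolding john_Lp_def
proof (rule the_equality, intro conjI allI impI)
  have self: "deltaJ_bar p (gauss \<phi>) (gauss \<phi>) = 1"
    using assms by (intro deltaJ_bar_gauss_self) auto
  then show "deltaJ_bar p (gauss \<phi>) (gauss \<phi>) \<le> 1"
    by simp
  show "\<exists>\<psi>. invertible \<psi> \<and> gauss \<phi> = gauss \<psi>"
    using assms by blast
  show "Jf (gauss \<psi>) \<le> Jf (gauss \<phi>)"
    if "invertible \<psi> \<and> deltaJ_bar p (gauss \<phi>) (gauss \<psi>) \<le> 1" for \<psi>
    using Jf_gauss_le_of_feasible assms that by blast
  fix g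
  assume "(\<exists>\<psi>. invertible \<psi> \<and> g = gauss \<psi>) \<and> deltaJ_bar p (gauss \<phi>) g \<le> 1
    \<and> (\<forall>\<psi>. invertible \<psi> \<and> deltaJ_bar p (gauss \<phi>) (gauss \<psi>) \<le> 1 \<longrightarrow> Jf (gauss \<psi>) \<le> Jf g)"
  then obtain \<psi> where \<psi>: "invertible \<psi>" and g: "g = gauss \<psi>"
    and feasible: "deltaJ_bar p (gauss \<phi>) (gauss \<psi>) \<le> 1"
    and maximal: "Jf (gauss \<phi>) \<le> Jf (gauss \<psi>)"
    using assms(2) self by force
  show "g = gauss \<phi>"
    using gauss_eq_of_feasible_Jf_ge[OF _ assms(2) \<psi> feasible maximal] assms(1) g by simp
qed

end
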